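(* Let $f\colon[0,\infty)\to[0,\infty)$ be amenable. Then the following statements are equivalent: (i) $f\in\mathbf{P}_{\mathbf{U}}$; (ii) the equality $$\min\{\max\{f(p),f(q)\},\max\{f(q),f(l)\},\max\{f(p),f(l)\}\}=\max\{f(p),f(q),f(l)\}$$ holds whenever $p,q,l\in[0,\infty)$ and $$\min\{\max\{p,q\},\max\{q,l\},\max\{p,l\}\}=\max\{p,q,l\}.$$
   Context: A function $f\colon[0,\infty)\to[0,\infty)$ is amenable if $f(0)=0$ and $f(x)>0$ for every $x\in(0,\infty)$. A metric space $(X,d)$ is ultrametric if $d(x,y)\leqslant\max\{d(x,z),d(z,y)\}$ for all $x,y,z\in X$. $\mathbf{P}_{\mathbf{U}}$ denotes the set of all ultrametric preserving functions, i.e. all $f\colon[0,\infty)\to[0,\infty)$ such that $(X,f\circ d)$ is an ultrametric space for every ultrametric space $(X,d)$, where $(f\circ d)(x,y)=f(d(x,y))$. *)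

theory Defs
  imports "HOL-Analysis.Analysis" "HOL-Library.FuncSet" "HOL-Library.Infinite_Typeclass"
begin

text \<open>
  A function from the half-line to itself is a function on the reals that maps
  \<open>{0..}\<close> to \<open>{0..}\<close>; its values at negative arguments play no role anywhere below.
\<close>

definition amenable :: "(real \<Rightarrow> real) \<Rightarrow> bool" where
  "amenable f \<longleftrightarrow> f 0 = 0 \<and> (\<forall>x>0. f x > 0)"

locale Ultrametric_space = Metric_space +
  assumes ultra: "\<lbrakk>x \<in> M; y \<in> M; z \<in> M\<rbrakk> \<Longrightarrow> d x y \<le> max (d x z) (d z y)"

text \<open>
  Higher-order logic cannot quantify over all sets at once, so the spaces are the sets \<open>X\<close> of
  elements of a type \<open>'a\<close>. The type is a parameter and is only required to be infinite:
  too small a type (fewer than three elements) would carry too few spaces. The spaces themselves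
  may be finite or infinite, of any cardinality up to that of \<open>'a\<close>. A theorem about all
  \<open>'a\<close> covers all ultrametric spaces, because every set embeds into an infinite type.
\<close>

definition ultrametric_preserving :: "'a::infinite itself \<Rightarrow> (real \<Rightarrow> real) set" where
  "ultrametric_preserving _ =
     {f \<in> {0..} \<rightarrow> {0..}.
        \<forall>(X :: 'a set) d. Ultrametric_space X d \<longrightarrow> Ultrametric_space X (\<lambda>x y. f (d x y))}"

end

theory Submission
  imports Defs
begin

text \<open>
  The equality between the minimum of the pairwise maxima and the maximum says that the two largest
  of the three numbers coincide, i.e. that each number is at most the maximum of the other two. Thus
  (ii) states that \<open>f\<close> preserves strong triangles. Applied to the sides of a triangle in an
  ultrametric space this gives (i); conversely, a strong triangle with positive sides is realised by
  a three-point ultrametric space.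
\<close>

definition strong_triangle :: "'a::linorder \<Rightarrow> 'a \<Rightarrow> 'a \<Rightarrow> bool" where
  "strong_triangle p q l \<longleftrightarrow> p \<le> max q l \<and> q \<le> max p l \<and> l \<le> max p q"

text \<open>The minimum of the pairwise maxima is the second largest of the three values.\<close>

lemma Min_max_eq_Max_iff_strong_triangle:
  fixes p q l :: "'a::linorder"
  shows "Min {max p q, max q l, max p l} = Max {p, q, l} \<longleftrightarrow> strong_triangle p q l"
  by (auto simp: strong_triangle_def max_def min_def)

text \<open>The ordinary triangle inequality comes for free, since the maximum of two nonnegative
  numbers is at most their sum. \<open>Metric_space\<close> demands nonnegativity and symmetry also
  outside \<open>X\<close>.\<close>

lemma Ultrametric_spaceI:
  assumes nonneg: "\<And>x y. 0 \<le> d x y"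
    and commute: "\<And>x y. d x y = d y x"
    and zero: "\<And>x y. \<lbrakk>x \<in> X; y \<in> X\<rbrakk> \<Longrightarrow> d x y = 0 \<longleftrightarrow> x = y"
    and ultra: "\<And>x y z. \<lbrakk>x \<in> X; y \<in> X; z \<in> X\<rbrakk> \<Longrightarrow> d x y \<le> max (d x z) (d z y)"
  shows "Ultrametric_space X d"
proof
  fix x y z assume "x \<in> X" "y \<in> X" "z \<in> X"
  then have "d x z \<le> max (d x y) (d y z)" by (simp add: ultra)
  also have "\<dots> \<le> d x y + d y z" using nonneg[of x y] nonneg[of y z] by simp
  finally show "d x z \<le> d x y + d y z" .
qed (use assms in auto)

text \<open>With third vertex \<open>c\<close>, the sides \<open>ab\<close>, \<open>bc\<close>,
  \<open>ac\<close> have lengths \<open>p\<close>, \<open>q\<close>, \<open>l\<close>. Leaving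
  \<open>c\<close> implicit makes the function total and symmetric on the whole type.\<close>

definition triangle_dist :: "'a \<Rightarrow> 'a \<Rightarrow> real \<Rightarrow> real \<Rightarrow> real \<Rightarrow> 'a \<Rightarrow> 'a \<Rightarrow> real" where
  "triangle_dist a b p q l x y =
     (if x = y then 0 else if {x, y} = {a, b} then p else if a \<in> {x, y} then l else q)"

lemma Ultrametric_space_triangle_dist:
  assumes "a \<noteq> b" "a \<noteq> c" "b \<noteq> c" and "0 < p" "0 < q" "0 < l" and "strong_triangle p q l"
  shows "Ultrametric_space {a, b, c} (triangle_dist a b p q l)"
  by (rule Ultrametric_spaceI)
    (use assms in \<open>auto simp: triangle_dist_def strong_triangle_def doubleton_eq_iff insert_commute\<close>)

lemma strong_triangle_preserved:
  fixes f :: "real \<Rightarrow> real"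
  assumes f: "f \<in> ultrametric_preserving TYPE('a::infinite)"
    and "f 0 = 0"
    and nonneg: "0 \<le> p" "0 \<le> q" "0 \<le> l"
    and tri: "strong_triangle p q l"
  shows "strong_triangle (f p) (f q) (f l)"
proof (cases "p = 0 \<or> q = 0 \<or> l = 0")
  case True
  have "0 \<le> f p" "0 \<le> f q" "0 \<le> f l"
    using f nonneg by (auto simp: ultrametric_preserving_def Pi_def)
  \<comment> \<open>A zero side would identify two vertices, so this case is done by hand: the other
    two sides agree, and \<open>f\<close> yields a triangle with sides 0, t, t.\<close>
  moreover have "p = 0 \<and> q = l \<or> q = 0 \<and> p = l \<or> l = 0 \<and> p = q"
    using True tri nonneg by (auto simp: strong_triangle_def max_def split: if_splits)
  ultimately show ?thesis
    using \<open>f 0 = 0\<close> by (auto simp: strong_triangle_def)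
next
  case False
  \<comment> \<open>Infinitude of the type supplies three distinct vertices.\<close>
  obtain A :: "'a set" where "card A = 3"
    using infinite_arbitrarily_large[OF infinite_UNIV] by blast
  then obtain a b c where abc: "a \<noteq> b" "a \<noteq> c" "b \<noteq> (c :: 'a)"
    by (auto simp: card_3_iff)
  let ?d = "triangle_dist a b p q l"
  have "Ultrametric_space {a, b, c} ?d"
    using False nonneg tri abc by (intro Ultrametric_space_triangle_dist) auto
  then interpret Ultrametric_space "{a, b, c}" "\<lambda>x y. f (?d x y)"
    using f by (auto simp: ultrametric_preserving_def)
  have "?d a b = p" "?d b a = p" "?d b c = q" "?d c b = q" "?d a c = l" "?d c a = l"
    using abc by (auto simp: triangle_dist_def doubleton_eq_iff)
  then show ?thesis
    using ultra[of a b c] ultra[of b c a] ultra[of a c b]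
    by (simp add: strong_triangle_def max.commute)
qed

lemma ultrametric_preservingI:
  fixes f :: "real \<Rightarrow> real"
  assumes f: "f \<in> {0..} \<rightarrow> {0..}" and "amenable f"
    and tri: "\<And>p q l. \<lbrakk>0 \<le> p; 0 \<le> q; 0 \<le> l; strong_triangle p q l\<rbrakk>
      \<Longrightarrow> strong_triangle (f p) (f q) (f l)"
  shows "f \<in> ultrametric_preserving TYPE('a::infinite)"
proof -
  \<comment> \<open>Amenability keeps distinct points at nonzero distance.\<close>
  have f_zero_iff: "f t = 0 \<longleftrightarrow> t = 0" if "0 \<le> t" for t
    using \<open>amenable f\<close> that by (metis amenable_def order_le_less order_less_irrefl)
  have "Ultrametric_space X (\<lambda>x y. f (d x y))" if "Ultrametric_space X d" for X :: "'a set" and d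
  proof -
    interpret Ultrametric_space X d by fact
    show ?thesis
    proof (rule Ultrametric_spaceI)
      fix x y z assume xyz: "x \<in> X" "y \<in> X" "z \<in> X"
      \<comment> \<open>Each side in turn is bounded through the opposite vertex.\<close>
      have "strong_triangle (d x y) (d x z) (d z y)"
        using ultra[of x y z] ultra[of x z y] ultra[of z y x] xyz
        by (simp add: strong_triangle_def commute max.commute)
      then show "f (d x y) \<le> max (f (d x z)) (f (d z y))"
        using tri[of "d x y" "d x z" "d z y"] by (simp add: strong_triangle_def)
    qed (use f in \<open>auto simp: Pi_def commute f_zero_iff\<close>)
  qed
  then show ?thesis
    using f by (simp add: ultrametric_preserving_def)
qed

theorem proposition35:
  fixes f :: "real \<Rightarrow> real"
  assumes "f \<in> {0..} \<rightarrow> {0..}"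
    and "amenable f"
  shows "f \<in> ultrametric_preserving TYPE('a::infinite) \<longleftrightarrow>
    (\<forall>p\<ge>0. \<forall>q\<ge>0. \<forall>l\<ge>0.
       Min {max p q, max q l, max p l} = Max {p, q, l} \<longrightarrow>
       Min {max (f p) (f q), max (f q) (f l), max (f p) (f l)} = Max {f p, f q, f l})"
  unfolding Min_max_eq_Max_iff_strong_triangle
  using strong_triangle_preserved[of f] ultrametric_preservingI[OF assms] assms(2)
  by (auto simp: amenable_def)

end
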